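(* Let $E$ be a real Hausdorff locally convex space and $\mathcal{K}\subset E$ a pointed cone. Consider the following statements. (i) $\mathcal{K}$ satisfies the weak property $(\pi)$. (ii) $\mathcal{K}^*$ has an order unit. (iii) There exists a sequence $\{x_n^*\}_n\subset\mathcal{K}^*$ such that $E^*=\bigcup_{n\ge1}[-nx_n^*,nx_n^*]$. Then (i)$\Rightarrow$(ii)$\Rightarrow$(iii). Furthermore, if $(E^*,\beta(E^*,E))$ is a Baire-like space, then (iii)$\Rightarrow$(i).
   Context: $E^*$ is the topological dual of $E$ and $\beta(E^*,E)$ the topology on $E^*$ of uniform convergence on bounded subsets of $E$. A cone $\mathcal{K}$ is a (nonempty) convex set with $\lambda k\in\mathcal{K}$ for all $\lambda\ge0$, $k\in\mathcal{K}$; it is pointed if $\mathcal{K}\cap(-\mathcal{K})=\{0\}$. $\mathcal{K}^*=\{x^*\in E^*: x^*(k)\ge0\ \forall k\in\mathcal{K}\}$. $\mathcal{K}$ satisfies the weak property $(\pi)$ if there exist $x^*\in\mathcal{K}^*$ and $\alpha>0$ such that $\mathcal{K}\cap\{x\in E:x^*(x)\le\alpha\}$ is bounded. A cone $\mathcal{P}$ in a vector space $F$ defines the order $x\le y\Leftrightarrow y-x\in\mathcal{P}$ and order intervals $[x,y]=\{z\in F:x\le z\le y\}$; $p\in\mathcal{P}$ is an order unit of $\mathcal{P}$ if $F=\bigcup_{n\ge1}[-np,np]$. In the claim this is used with $F=E^*$, $\mathcal{P}=\mathcal{K}^*$. A set in a topological space is rare if its closure has empty interior. A locally convex space is Baire-like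 if it cannot be covered by any increasing sequence of rare, balanced, convex sets. *)

theory Defs
  imports "HOL-Analysis.Analysis"
begin

section \<open>Locally convex spaces\<close>

class locally_convex_space = real_vector + topological_ab_group_add + t2_space +
  assumes tendsto_scaleR_Pair:
    "LIM p (nhds (c :: real) \<times>\<^sub>F nhds x). fst p *\<^sub>R snd p :> nhds (c *\<^sub>R x)"
  assumes locally_convex:
    "open U \<Longrightarrow> 0 \<in> U \<Longrightarrow> \<exists>V. open V \<and> 0 \<in> V \<and> V \<subseteq> U \<and>
       (\<forall>x\<in>V. \<forall>y\<in>V. \<forall>u\<ge>0. \<forall>v\<ge>0. u + v = 1 \<longrightarrow> u *\<^sub>R x + v *\<^sub>R y \<in> V)"
  \<comment> \<open>\<^const>\<open>convex\<close> is not available inside a class specification\<close>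

lemma locally_convex_space_convex_nhd:
  fixes U :: "'a::locally_convex_space set"
  assumes "open U" "0 \<in> U"
  obtains V where "open V" "convex V" "0 \<in> V" "V \<subseteq> U"
  using locally_convex[OF assms] unfolding convex_def by blast

instance real_normed_vector \<subseteq> locally_convex_space
proof
  fix c :: real and x :: 'a
  show "LIM p (nhds c \<times>\<^sub>F nhds x). fst p *\<^sub>R snd p :> nhds (c *\<^sub>R x)"
    by (intro tendsto_scaleR filterlim_fst filterlim_snd)
next
  fix U :: "'a set"
  assume "open U" "0 \<in> U"
  then obtain e where "e > 0" "ball 0 e \<subseteq> U"
    by (rule openE)
  then show "\<exists>V. open V \<and> 0 \<in> V \<and> V \<subseteq> U \<and>
      (\<forall>x\<in>V. \<forall>y\<in>V. \<forall>u\<ge>0. \<forall>v\<ge>0. u + v = 1 \<longrightarrow> u *\<^sub>R x + v *\<^sub>R y \<in> V)"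
    using convex_ball[of "0 :: 'a" e]
    by (intro exI[of _ "ball 0 e"]) (simp add: convex_def)
qed

text \<open>Boundedness in the sense of topological vector spaces (absorbed by every neighbourhood
  of the origin); the library constant \<^const>\<open>bounded\<close> is the metric notion.\<close>

definition tvs_bounded :: "'a::locally_convex_space set \<Rightarrow> bool" where
  "tvs_bounded B \<longleftrightarrow>
     (\<forall>U. open U \<and> 0 \<in> U \<longrightarrow> (\<exists>r>0. \<forall>t\<ge>r. B \<subseteq> (\<lambda>x. t *\<^sub>R x) ` U))"

lemma tvs_bounded_empty: "tvs_bounded {}"
  by (auto simp: tvs_bounded_def intro: exI[of _ 1])

lemma tvs_bounded_Un:
  assumes "tvs_bounded A" "tvs_bounded B"
  shows "tvs_bounded (A \<union> B)"
  unfolding tvs_bounded_def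
proof (intro allI impI)
  fix U :: "'a set"
  assume "open U \<and> 0 \<in> U"
  with assms obtain r s where "r > 0" "\<forall>t\<ge>r. A \<subseteq> (\<lambda>x. t *\<^sub>R x) ` U"
    and "s > 0" "\<forall>t\<ge>s. B \<subseteq> (\<lambda>x. t *\<^sub>R x) ` U"
    unfolding tvs_bounded_def by meson
  then show "\<exists>r>0. \<forall>t\<ge>r. A \<union> B \<subseteq> (\<lambda>x. t *\<^sub>R x) ` U"
    by (intro exI[of _ "max r s"]) auto
qed


section \<open>The topological dual and its strong topology\<close>

typedef (overloaded) 'a top_dual =
  "{f :: 'a::locally_convex_space \<Rightarrow> real. linear f \<and> continuous_on UNIV f}"
  morphisms dual_apply Abs_top_dual
  by (rule exI[of _ "\<lambda>_. 0"]) (auto simp: linear_iff)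

setup_lifting type_definition_top_dual

lemma top_dual_eqI: "(\<And>x. dual_apply f x = dual_apply g x) \<Longrightarrow> f = g"
  by transfer auto

instantiation top_dual :: (locally_convex_space) real_vector
begin

lift_definition zero_top_dual :: "'a top_dual" is "\<lambda>_. 0"
  by (auto simp: linear_iff)

lift_definition plus_top_dual :: "'a top_dual \<Rightarrow> 'a top_dual \<Rightarrow> 'a top_dual"
  is "\<lambda>f g x. f x + g x"
  by (auto simp: linear_iff algebra_simps intro!: continuous_intros)

lift_definition uminus_top_dual :: "'a top_dual \<Rightarrow> 'a top_dual"
  is "\<lambda>f x. - f x"
  by (auto simp: linear_iff intro!: continuous_intros)

lift_definition minus_top_dual :: "'a top_dual \<Rightarrow> 'a top_dual \<Rightarrow> 'a top_dual"
  is "\<lambda>f g x. f x - g x"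
  by (auto simp: linear_iff algebra_simps intro!: continuous_intros)

lift_definition scaleR_top_dual :: "real \<Rightarrow> 'a top_dual \<Rightarrow> 'a top_dual"
  is "\<lambda>c f x. c * f x"
  by (auto simp: linear_iff algebra_simps intro!: continuous_intros)

instance
  by standard (transfer; auto simp: algebra_simps)+

end

text \<open>The sets \<open>{g. \<forall>x\<in>B. \<bar>g x - f x\<bar> < e}\<close>, with \<open>B\<close> bounded and \<open>e > 0\<close>, form a
  neighbourhood base at \<open>f\<close>, but need not be open themselves.\<close>

definition strong_dual_open :: "'a::locally_convex_space top_dual set \<Rightarrow> bool" where
  "strong_dual_open W \<longleftrightarrow>
     (\<forall>f\<in>W. \<exists>B e. tvs_bounded B \<and> e > 0 \<and>
        {g. \<forall>x\<in>B. \<bar>dual_apply g x - dual_apply f x\<bar> < e} \<subseteq> W)"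

definition strong_dual_topology :: "'a::locally_convex_space top_dual topology" where
  "strong_dual_topology = topology strong_dual_open"

lemma istopology_strong_dual_open: "istopology strong_dual_open"
  unfolding istopology_def
proof (intro conjI allI impI)
  fix S T :: "'a top_dual set"
  assume S: "strong_dual_open S" and T: "strong_dual_open T"
  show "strong_dual_open (S \<inter> T)"
    unfolding strong_dual_open_def
  proof
    fix f assume f: "f \<in> S \<inter> T"
    from S f obtain A d where A: "tvs_bounded A" "d > 0"
      "{g. \<forall>x\<in>A. \<bar>dual_apply g x - dual_apply f x\<bar> < d} \<subseteq> S"
      unfolding strong_dual_open_def by blast
    from T f obtain B e where B: "tvs_bounded B" "e > 0"
      "{g. \<forall>x\<in>B. \<bar>dual_apply g x - dual_apply f x\<bar> < e} \<subseteq> T"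
      unfolding strong_dual_open_def by blast
    show "\<exists>B e. tvs_bounded B \<and> e > 0 \<and>
        {g. \<forall>x\<in>B. \<bar>dual_apply g x - dual_apply f x\<bar> < e} \<subseteq> S \<inter> T"
    proof (intro exI conjI)
      show "tvs_bounded (A \<union> B)"
        using A(1) B(1) by (rule tvs_bounded_Un)
      show "min d e > 0"
        using A(2) B(2) by simp
      show "{g. \<forall>x\<in>A \<union> B. \<bar>dual_apply g x - dual_apply f x\<bar> < min d e} \<subseteq> S \<inter> T"
        by (rule subset_trans[OF _ Int_mono[OF A(3) B(3)]]) auto
    qed
  qed
next
  fix \<W> :: "'a top_dual set set"
  assume \<W>: "\<forall>W\<in>\<W>. strong_dual_open W"
  show "strong_dual_open (\<Union>\<W>)"
    unfolding strong_dual_open_def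
  proof
    fix f assume "f \<in> \<Union>\<W>"
    then obtain W where "f \<in> W" "W \<in> \<W>" ..
    with \<W> obtain B e where "tvs_bounded B" "e > 0"
      "{g. \<forall>x\<in>B. \<bar>dual_apply g x - dual_apply f x\<bar> < e} \<subseteq> W"
      unfolding strong_dual_open_def by blast
    moreover have "W \<subseteq> \<Union>\<W>"
      using \<open>W \<in> \<W>\<close> by (rule Union_upper)
    ultimately show "\<exists>B e. tvs_bounded B \<and> e > 0 \<and>
        {g. \<forall>x\<in>B. \<bar>dual_apply g x - dual_apply f x\<bar> < e} \<subseteq> \<Union>\<W>"
      by (intro exI conjI) (assumption | rule subset_trans)+
  qed
qed

lemma openin_strong_dual_topology:
  "openin strong_dual_topology W \<longleftrightarrow> strong_dual_open W"
  by (simp add: strong_dual_topology_def topology_inverse' istopology_strong_dual_open)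

lemma topspace_strong_dual_topology: "topspace strong_dual_topology = UNIV"
proof -
  have "openin strong_dual_topology (UNIV :: 'a top_dual set)"
    unfolding openin_strong_dual_topology strong_dual_open_def
    using tvs_bounded_empty zero_less_one by blast
  then show ?thesis
    using openin_subset by blast
qed


section \<open>Rare sets and Baire-like spaces\<close>

definition rare :: "'a topology \<Rightarrow> 'a set \<Rightarrow> bool" where
  "rare T S \<longleftrightarrow> T interior_of (T closure_of S) = {}"

definition balanced :: "'a::real_vector set \<Rightarrow> bool" where
  "balanced S \<longleftrightarrow> (\<forall>x\<in>S. \<forall>c::real. \<bar>c\<bar> \<le> 1 \<longrightarrow> c *\<^sub>R x \<in> S)"

definition baire_like :: "'a::real_vector topology \<Rightarrow> bool" where
  "baire_like T \<longleftrightarrow>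
     \<not> (\<exists>A :: nat \<Rightarrow> 'a set. incseq A \<and>
          (\<forall>n. rare T (A n) \<and> balanced (A n) \<and> convex (A n)) \<and>
          topspace T \<subseteq> (\<Union>n. A n))"


section \<open>Cones\<close>

definition pointed :: "'a::real_vector set \<Rightarrow> bool" where
  "pointed K \<longleftrightarrow> K \<inter> uminus ` K = {0}"

definition dual_cone :: "'a::locally_convex_space set \<Rightarrow> 'a top_dual set" where
  "dual_cone K = {f. \<forall>k\<in>K. 0 \<le> dual_apply f k}"

definition weak_property_pi :: "'a::locally_convex_space set \<Rightarrow> bool" where
  "weak_property_pi K \<longleftrightarrow>
     (\<exists>f\<in>dual_cone K. \<exists>\<alpha>>0. tvs_bounded (K \<inter> {x. dual_apply f x \<le> \<alpha>}))"

definition cone_le :: "'f::real_vector set \<Rightarrow> 'f \<Rightarrow> 'f \<Rightarrow> bool" where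
  "cone_le P x y \<longleftrightarrow> y - x \<in> P"

definition order_interval :: "'f::real_vector set \<Rightarrow> 'f \<Rightarrow> 'f \<Rightarrow> 'f set" where
  "order_interval P x y = {z. cone_le P x z \<and> cone_le P z y}"

definition order_unit :: "'f::real_vector set \<Rightarrow> 'f \<Rightarrow> bool" where
  "order_unit P p \<longleftrightarrow> p \<in> P \<and>
     UNIV = (\<Union>n\<in>{1::nat..}. order_interval P (- (real n *\<^sub>R p)) (real n *\<^sub>R p))"

end

theory Submission
  imports Defs
begin

text \<open>
  For \<open>(i) \<Longrightarrow> (ii)\<close> the functional \<open>f\<close> cutting out the bounded slice is itself an order unit: a
  continuous functional is bounded on the slice, hence on \<open>K\<close> it is dominated by a multiple of \<open>f\<close>.

  For \<open>(iii) \<Longrightarrow> (i)\<close> put \<open>y\<^sub>n = (\<Sum>i\<le>n. i x\<^sub>i)\<close>. The order intervals \<open>[-y\<^sub>n, y\<^sub>n]\<close> increase, cover the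
  dual and are absolutely convex and strongly closed, so one of them contains the polar of a bounded
  set \<open>B\<close>. The slice \<open>K \<inter> {y\<^sub>n \<le> 1}\<close> then lies in a multiple of the bipolar of \<open>B\<close>, and is
  bounded by the Hahn--Banach theorem.
\<close>

section \<open>The Hahn--Banach theorem\<close>

text \<open>Homogeneity is asked for only as an inequality and only for \<open>c > 0\<close>, which
  leaves less to check for the infima below; applying it to \<open>inverse c\<close> as well
  recovers equality.\<close>

definition sublinear :: "('a::real_vector \<Rightarrow> real) \<Rightarrow> bool" where
  "sublinear p \<longleftrightarrow>
     (\<forall>x y. p (x + y) \<le> p x + p y) \<and> (\<forall>c>0. \<forall>x. p (c *\<^sub>R x) \<le> c * p x)"

lemma sublinear_add: "sublinear p \<Longrightarrow> p (x + y) \<le> p x + p y"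
  by (simp add: sublinear_def)

lemma sublinear_zero:
  assumes "sublinear p"
  shows "p 0 = 0"
proof -
  have "p 0 \<le> c * p 0" if "c > 0" for c
    using assms that unfolding sublinear_def by (metis scaleR_zero_right)
  \<comment> \<open>The factor 2 gives \<open>0 \<le> p 0\<close>, the factor 1/2 gives
    \<open>p 0 \<le> 0\<close>.\<close>
  from this[of 2] this[of "1/2"] show ?thesis by simp
qed

lemma sublinear_scaleR:
  assumes "sublinear p" "c \<ge> 0"
  shows "p (c *\<^sub>R x) = c * p x"
proof (cases "c = 0")
  case True
  then show ?thesis by (simp add: sublinear_zero[OF assms(1)])
next
  case False
  with assms have c: "c > 0" by simp
  have "p (inverse c *\<^sub>R c *\<^sub>R x) \<le> inverse c * p (c *\<^sub>R x)"
    using assms(1) c unfolding sublinear_def by (meson positive_imp_inverse_positive)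
  then have "c * p x \<le> p (c *\<^sub>R x)"
    using c by (simp add: field_simps)
  moreover have "p (c *\<^sub>R x) \<le> c * p x"
    using assms(1) c by (simp add: sublinear_def)
  ultimately show ?thesis by simp
qed

text \<open>For a family of sublinear functionals below a fixed one, this yields a common lower
  bound at each point, so that pointwise infima exist.\<close>

lemma sublinear_uminus_lower: "sublinear p \<Longrightarrow> - p (- x) \<le> p x"
  using sublinear_add[of p x "- x"] sublinear_zero[of p] by simp

text \<open>The largest sublinear functional below \<open>p\<close> that is linear along the line through \<open>a\<close> and
  agrees with \<open>p\<close> at \<open>a\<close>.\<close>

definition linearize_along :: "('a::real_vector \<Rightarrow> real) \<Rightarrow> 'a \<Rightarrow> 'a \<Rightarrow> real" where
  "linearize_along p a x = (INF t\<in>{0..}. p (x + t *\<^sub>R a) - t * p a)"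

lemma linearize_along_le:
  assumes "sublinear p" "t \<ge> 0"
  shows "linearize_along p a x \<le> p (x + t *\<^sub>R a) - t * p a"
  unfolding linearize_along_def
proof (rule cINF_lower)
  show "bdd_below ((\<lambda>t. p (x + t *\<^sub>R a) - t * p a) ` {0..})"
  proof (rule bdd_belowI2)
    fix s :: real assume "s \<in> {0..}"
    \<comment> \<open>Subadditivity for \<open>s *\<^sub>R a = (x + s *\<^sub>R a) + (- x)\<close>
      gives a lower bound independent of \<open>s\<close>.\<close>
    then show "- p (- x) \<le> p (x + s *\<^sub>R a) - s * p a"
      using sublinear_add[OF assms(1), of "x + s *\<^sub>R a" "- x"]
        sublinear_scaleR[OF assms(1), of s a] by simp
  qed
qed (use assms in simp)

lemma linearize_along_greatest:
  assumes "\<And>t. t \<ge> 0 \<Longrightarrow> m \<le> p (x + t *\<^sub>R a) - t * p a"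
  shows "m \<le> linearize_along p a x"
  unfolding linearize_along_def by (rule cINF_greatest) (use assms in auto)

text \<open>Parameters \<open>s\<close> for \<open>x\<close> and \<open>t\<close> for
  \<open>y\<close> add up to a parameter \<open>s + t\<close> for \<open>x + y\<close>, and scaling
  by \<open>c\<close> turns \<open>t\<close> into \<open>c * t\<close>. The infima over
  \<open>t\<close> and \<open>s\<close> are then taken one after the other.\<close>

lemma sublinear_linearize_along:
  assumes p: "sublinear p"
  shows "sublinear (linearize_along p a)"
  unfolding sublinear_def
proof (intro conjI allI impI)
  fix x y
  let ?q = "linearize_along p a"
  have le: "?q (x + y) \<le> (p (x + s *\<^sub>R a) - s * p a) + (p (y + t *\<^sub>R a) - t * p a)"
    if "s \<ge> 0" "t \<ge> 0" for s t :: real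
    using linearize_along_le[OF p, of "s + t" a "x + y"] that
      sublinear_add[OF p, of "x + s *\<^sub>R a" "y + t *\<^sub>R a"]
    by (simp add: algebra_simps)
  have le': "?q (x + y) - (p (x + s *\<^sub>R a) - s * p a) \<le> ?q y" if "s \<ge> 0" for s
  proof (rule linearize_along_greatest)
    fix t :: real assume "t \<ge> 0"
    from le[OF that this]
    show "?q (x + y) - (p (x + s *\<^sub>R a) - s * p a) \<le> p (y + t *\<^sub>R a) - t * p a" by linarith
  qed
  have "?q (x + y) - ?q y \<le> ?q x"
  proof (rule linearize_along_greatest)
    fix s :: real assume "s \<ge> 0"
    from le'[OF this] show "?q (x + y) - ?q y \<le> p (x + s *\<^sub>R a) - s * p a" by linarith
  qed
  then show "?q (x + y) \<le> ?q x + ?q y" by simp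
next
  fix c :: real and x assume c: "c > 0"
  let ?q = "linearize_along p a"
  have "inverse c * ?q (c *\<^sub>R x) \<le> ?q x"
  proof (rule linearize_along_greatest)
    fix t :: real assume t: "t \<ge> 0"
    have "?q (c *\<^sub>R x) \<le> p (c *\<^sub>R (x + t *\<^sub>R a)) - (c * t) * p a"
      using linearize_along_le[OF p, of "c * t" a "c *\<^sub>R x"] c t by (simp add: algebra_simps)
    also have "\<dots> = c * (p (x + t *\<^sub>R a) - t * p a)"
      using sublinear_scaleR[OF p, of c "x + t *\<^sub>R a"] c by (simp add: right_diff_distrib)
    finally show "inverse c * ?q (c *\<^sub>R x) \<le> p (x + t *\<^sub>R a) - t * p a"
      using c by (simp add: field_simps)
  qed
  then show "?q (c *\<^sub>R x) \<le> c * ?q x" using c by (simp add: field_simps)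
qed

lemma linearize_along_le_self: "sublinear p \<Longrightarrow> linearize_along p a \<le> p"
  using linearize_along_le[of p 0 a] by (auto intro: le_funI)

text \<open>The parameter \<open>t = 1\<close> gives \<open>p 0 - p a\<close>. This inequality is
  what forces minimal sublinear functionals to be odd.\<close>

lemma linearize_along_uminus_self: "sublinear p \<Longrightarrow> linearize_along p a (- a) \<le> - p a"
  using linearize_along_le[of p 1 a "- a"] sublinear_zero[of p] by simp

text \<open>Supplies the bounds for Zorn's lemma. Comparability is what saves subadditivity: of two
  members of the chain, the smaller one can be used at both \<open>x\<close> and
  \<open>y\<close>.\<close>

lemma sublinear_INF_chain:
  assumes sub: "\<And>q. q \<in> C \<Longrightarrow> sublinear q" and le: "\<And>q. q \<in> C \<Longrightarrow> q \<le> p"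
    and chain: "\<And>q r. q \<in> C \<Longrightarrow> r \<in> C \<Longrightarrow> q \<le> r \<or> r \<le> q"
    and "C \<noteq> {}"
  shows "sublinear (\<lambda>x. INF q\<in>C. q x)" and "\<And>q. q \<in> C \<Longrightarrow> (\<lambda>x. INF q\<in>C. q x) \<le> q"
proof -
  let ?m = "\<lambda>x. INF q\<in>C. q x"
  have bdd: "bdd_below ((\<lambda>q. q x) ` C)" for x
  proof (rule bdd_belowI2)
    fix q assume "q \<in> C"
    with sub le have "sublinear q" "q (- x) \<le> p (- x)" by (auto simp: le_fun_def)
    then show "- p (- x) \<le> q x" using sublinear_uminus_lower[of q x] by linarith
  qed
  then have lower: "?m x \<le> q x" if "q \<in> C" for q x
    using that by (rule cINF_lower)
  then show "\<And>q. q \<in> C \<Longrightarrow> ?m \<le> q" by (simp add: le_funI)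
  show "sublinear ?m"
    unfolding sublinear_def
  proof (intro conjI allI impI)
    fix x y
    have "?m (x + y) \<le> q x + r y" if qr: "q \<in> C" "r \<in> C" for q r
    proof -
      obtain s where s: "s \<in> C" "s \<le> q" "s \<le> r" using chain[OF qr] qr by blast
      then have "?m (x + y) \<le> s x + s y"
        using lower[OF s(1)] sublinear_add sub by (meson order_trans)
      also have "\<dots> \<le> q x + r y" using s by (intro add_mono) (auto simp: le_fun_def)
      finally show ?thesis .
    qed
    then have *: "?m (x + y) - q x \<le> r y" if "q \<in> C" "r \<in> C" for q r
      using that by (simp add: diff_le_eq add.commute)
    have "?m (x + y) - q x \<le> ?m y" if "q \<in> C" for q
      by (rule cINF_greatest[OF \<open>C \<noteq> {}\<close>]) (rule *[OF that])
    then have **: "?m (x + y) - ?m y \<le> q x" if "q \<in> C" for q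
      using that by (simp add: diff_le_eq add.commute)
    have "?m (x + y) - ?m y \<le> ?m x"
      by (rule cINF_greatest[OF \<open>C \<noteq> {}\<close>]) (rule **)
    then show "?m (x + y) \<le> ?m x + ?m y" by simp
  next
    fix c :: real and x assume c: "c > 0"
    have "inverse c * ?m (c *\<^sub>R x) \<le> ?m x"
    proof (rule cINF_greatest[OF \<open>C \<noteq> {}\<close>])
      fix q assume q: "q \<in> C"
      with sub have "q (c *\<^sub>R x) = c * q x" using c by (simp add: sublinear_scaleR)
      with lower[OF q, of "c *\<^sub>R x"] c show "inverse c * ?m (c *\<^sub>R x) \<le> q x"
        by (simp add: field_simps)
    qed
    then show "?m (c *\<^sub>R x) \<le> c * ?m x" using c by (simp add: field_simps)
  qed
qed

text \<open>Zorn's lemma for the reversed pointwise order, in which maximal elements are the minimal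
  functionals.\<close>

lemma minimal_sublinear_exists:
  fixes p :: "'a::real_vector \<Rightarrow> real"
  assumes "sublinear p"
  obtains q where "sublinear q" "q \<le> p" "\<And>r. sublinear r \<Longrightarrow> r \<le> q \<Longrightarrow> r = q"
proof -
  define A where "A = {q. sublinear q \<and> q \<le> p}"
  have "\<exists>m\<in>A. \<forall>a\<in>A. a \<le> m \<longrightarrow> a = m"
  proof (rule predicate_Zorn[where P = "\<lambda>f g. g \<le> f"])
    show "partial_order_on A (relation_of (\<lambda>f g. g \<le> f) A)"
      by (rule partial_order_on_relation_ofI) auto
    fix C assume "C \<in> Chains (relation_of (\<lambda>f g. g \<le> f) A)"
    then have C: "\<And>q r. q \<in> C \<Longrightarrow> r \<in> C \<Longrightarrow> q \<in> A \<and> r \<in> A \<and> (q \<le> r \<or> r \<le> q)"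
      by (auto simp: Chains_def relation_of_def)
    show "\<exists>u\<in>A. \<forall>a\<in>C. u \<le> a"
    \<comment> \<open>An infimum over the empty chain carries no information, so there
      \<open>p\<close> itself is the bound.\<close>
    proof (cases "C = {}")
      case True
      then show ?thesis using assms by (auto simp: A_def)
    next
      case False
      then obtain q where q: "q \<in> C" by blast
      have sub: "\<And>q. q \<in> C \<Longrightarrow> sublinear q" and le: "\<And>q. q \<in> C \<Longrightarrow> q \<le> p"
        using C by (auto simp: A_def)
      have chain: "\<And>q r. q \<in> C \<Longrightarrow> r \<in> C \<Longrightarrow> q \<le> r \<or> r \<le> q" using C by blast
      have inf: "sublinear (\<lambda>x. INF q\<in>C. q x)"
        using sub le chain False by (rule sublinear_INF_chain(1))
      have lower: "(\<lambda>x. INF q\<in>C. q x) \<le> q" if "q \<in> C" for q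
        using sub le chain False that by (rule sublinear_INF_chain(2))
      have "(\<lambda>x. INF q\<in>C. q x) \<in> A"
        using inf order_trans[OF lower[OF q] le[OF q]] by (simp add: A_def)
      then show ?thesis using lower by blast
    qed
  qed
  then obtain q where q: "q \<in> A" and min: "\<And>a. a \<in> A \<Longrightarrow> a \<le> q \<Longrightarrow> a = q" by blast
  show thesis
  proof (rule that[of q])
    fix r assume "sublinear r" "r \<le> q"
    with q show "r = q" by (intro min) (auto simp: A_def intro: order_trans)
  qed (use q in \<open>simp_all add: A_def\<close>)
qed

text \<open>Minimality forces \<open>linearize_along q a = q\<close> for every \<open>a\<close>,
  hence \<open>q (- a) = - q a\<close>. Subadditivity at \<open>- x\<close> and \<open>- y\<close>
  then reverses the one at \<open>x\<close> and \<open>y\<close>.\<close>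

lemma minimal_sublinear_linear:
  assumes q: "sublinear q" and min: "\<And>r. sublinear r \<Longrightarrow> r \<le> q \<Longrightarrow> r = q"
  shows "linear q"
proof -
  have neg: "q (- a) = - q a" for a
  proof -
    have "linearize_along q a = q"
      using q by (intro min sublinear_linearize_along linearize_along_le_self)
    then show ?thesis
      using linearize_along_uminus_self[OF q, of a] sublinear_uminus_lower[OF q, of a] by simp
  qed
  show ?thesis
  proof (rule linearI)
    fix x y
    show "q (x + y) = q x + q y"
      using sublinear_add[OF q, of x y] sublinear_add[OF q, of "- x" "- y"] neg[of "x + y"]
      by (simp add: neg)
  next
    fix c x
    show "q (c *\<^sub>R x) = c *\<^sub>R q x"
    proof (cases "c \<ge> 0")
      case True
      then show ?thesis by (simp add: sublinear_scaleR[OF q])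
    next
      case False
      then have "q ((- c) *\<^sub>R x) = (- c) * q x" by (intro sublinear_scaleR[OF q]) simp
      then show ?thesis by (simp add: neg)
    qed
  qed
qed

text \<open>The minimal functional is taken below \<open>linearize_along p a\<close> instead of
  \<open>p\<close>: this gives \<open>f (- a) \<le> - p a\<close>, and so the prescribed value at
  \<open>a\<close>.\<close>

theorem Hahn_Banach_sublinear:
  fixes p :: "'a::real_vector \<Rightarrow> real"
  assumes p: "sublinear p"
  obtains f where "linear f" "f \<le> p" "f a = p a"
proof -
  obtain f where f: "sublinear f" "f \<le> linearize_along p a"
      "\<And>r. sublinear r \<Longrightarrow> r \<le> f \<Longrightarrow> r = f"
    using minimal_sublinear_exists[OF sublinear_linearize_along[OF p]] by metis
  have lin: "linear f" using f(1,3) by (rule minimal_sublinear_linear)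
  have "f \<le> p" using f(2) linearize_along_le_self[OF p] by (rule order_trans)
  moreover have "p a \<le> f a"
    using le_funD[OF f(2), of "- a"] linearize_along_uminus_self[OF p, of a]
    by (simp add: linear_neg[OF lin])
  ultimately show thesis using lin by (intro that[of f]) (auto simp: le_fun_def intro: antisym)
qed

section \<open>Locally convex spaces\<close>

lemma continuous_on_scaleR_const:
  "continuous_on UNIV (\<lambda>x::'a::locally_convex_space. c *\<^sub>R x)"
proof -
  have "((\<lambda>y. c *\<^sub>R y) \<longlongrightarrow> c *\<^sub>R x) (at x)" for x :: 'a
  proof -
    have "filterlim (\<lambda>y. (c, y)) (nhds c \<times>\<^sub>F nhds x) (at x)"
      by (intro filterlim_Pair tendsto_const tendsto_ident_at)
    from filterlim_compose[OF tendsto_scaleR_Pair this] show ?thesis by simp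
  qed
  then show ?thesis by (simp add: continuous_on_def)
qed

lemma tendsto_scaleR_zero_locally_convex:
  fixes x :: "'a::locally_convex_space"
  assumes "(f \<longlongrightarrow> 0) F"
  shows "((\<lambda>t. f t *\<^sub>R x) \<longlongrightarrow> 0) F"
proof -
  have "filterlim (\<lambda>t. (f t, x)) (nhds 0 \<times>\<^sub>F nhds x) F"
    using assms by (intro filterlim_Pair tendsto_const)
  from filterlim_compose[OF tendsto_scaleR_Pair this] show ?thesis by simp
qed

text \<open>Neighbourhoods of the origin are absorbing. This makes singletons bounded and the set of
  scalars in a gauge nonempty.\<close>

lemma eventually_inverse_scaleR_in:
  fixes x :: "'a::locally_convex_space"
  assumes "open U" "0 \<in> U"
  shows "\<forall>\<^sub>F t in at_top. inverse t *\<^sub>R x \<in> U"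
proof -
  have "((\<lambda>t::real. inverse t *\<^sub>R x) \<longlongrightarrow> 0) at_top"
    by (intro tendsto_scaleR_zero_locally_convex tendsto_inverse_0_at_top filterlim_ident)
  from topological_tendstoD[OF this assms] show ?thesis .
qed

lemma in_scaleR_image_iff:
  fixes x :: "'a::real_vector"
  assumes "t \<noteq> 0"
  shows "x \<in> (\<lambda>x. t *\<^sub>R x) ` U \<longleftrightarrow> inverse t *\<^sub>R x \<in> U"
  using assms by (force simp: image_iff)

lemma tvs_boundedE:
  assumes "tvs_bounded B" "open U" "0 \<in> U"
  obtains r where "r > 0" "\<And>x. x \<in> B \<Longrightarrow> inverse r *\<^sub>R x \<in> U"
proof -
  obtain r where r: "r > 0" "\<forall>t\<ge>r. B \<subseteq> (\<lambda>x. t *\<^sub>R x) ` U"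
    using assms unfolding tvs_bounded_def by meson
  then have "B \<subseteq> (\<lambda>x. r *\<^sub>R x) ` U" by simp
  with r(1) show thesis
    by (intro that[of r]) (auto simp: in_scaleR_image_iff[symmetric])
qed

lemma tvs_bounded_singleton: "tvs_bounded {x}"
  unfolding tvs_bounded_def
proof (intro allI impI)
  fix U :: "'a set" assume "open U \<and> 0 \<in> U"
  then obtain N where N: "\<And>t. t \<ge> N \<Longrightarrow> inverse t *\<^sub>R x \<in> U"
    using eventually_inverse_scaleR_in[of U x] by (auto simp: eventually_at_top_linorder)
  then have "inverse t *\<^sub>R x \<in> U \<and> t \<noteq> 0" if "t \<ge> max N 1" for t
    using that by auto
  then have "\<forall>t\<ge>max N 1. {x} \<subseteq> (\<lambda>x. t *\<^sub>R x) ` U"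
    by (simp add: in_scaleR_image_iff)
  then show "\<exists>r>0. \<forall>t\<ge>r. {x} \<subseteq> (\<lambda>x. t *\<^sub>R x) ` U"
    by (intro exI[of _ "max N 1"]) auto
qed

text \<open>Symmetry later turns an upper bound for a linear functional on \<open>V\<close> into a
  bound for its absolute value.\<close>

lemma locally_convex_space_symmetric_nhd:
  fixes U :: "'a::locally_convex_space set"
  assumes "open U" "0 \<in> U"
  obtains V where "open V" "convex V" "0 \<in> V" "V \<subseteq> U" "\<And>x. x \<in> V \<Longrightarrow> - x \<in> V"
proof -
  obtain V where V: "open V" "convex V" "0 \<in> V" "V \<subseteq> U"
    using locally_convex_space_convex_nhd[OF assms] .
  have "open (uminus -` V)"
    using V(1) by (intro open_vimage) (auto intro: continuous_intros)
  moreover have "convex (uminus -` V)"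
    using V(2) by (intro convex_linear_vimage module_hom_uminus)
  ultimately show thesis
    using V by (intro that[of "V \<inter> uminus -` V"]) (auto intro: convex_Int)
qed

lemma continuous_on_linear_bounded_nhd:
  fixes f :: "'a::locally_convex_space \<Rightarrow> real"
  assumes f: "linear f" and V: "open V" "0 \<in> V" "\<And>x. x \<in> V \<Longrightarrow> \<bar>f x\<bar> \<le> 1"
  shows "continuous_on UNIV f"
proof -
  have "(f \<longlongrightarrow> f x) (at x)" for x
  proof (rule tendstoI)
    fix e :: real assume e: "e > 0"
    \<comment> \<open>The factor \<open>2 / e\<close> yields the bound \<open>e / 2\<close>, and so
      a strict inequality.\<close>
    let ?g = "\<lambda>y. (2 / e) *\<^sub>R (y - x)"
    have "continuous_on UNIV ?g"
      by (rule continuous_on_compose2[OF continuous_on_scaleR_const])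
        (auto intro: continuous_intros)
    then have "isCont ?g x" by (simp add: continuous_on_eq_continuous_at)
    then have "(?g \<longlongrightarrow> 0) (at x)" by (simp add: isCont_def)
    from topological_tendstoD[OF this V(1,2)]
    show "\<forall>\<^sub>F y in at x. dist (f y) (f x) < e"
    proof eventually_elim
      case (elim y)
      have "f (?g y) = (2 / e) * (f y - f x)"
        by (simp only: linear_scale[OF f] linear_diff[OF f] real_scaleR_def)
      then have "\<bar>f (?g y)\<bar> = (2 / e) * \<bar>f y - f x\<bar>"
        using e by (simp only: abs_mult) simp
      with V(3)[OF elim] have "(2 / e) * \<bar>f y - f x\<bar> \<le> 1" by linarith
      with e have "\<bar>f y - f x\<bar> * 2 \<le> e" by (simp add: field_simps)
      with e show ?case by (simp add: dist_real_def)
    qed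
  qed
  then show ?thesis by (simp add: continuous_on_def)
qed

section \<open>The Minkowski functional and separation by continuous functionals\<close>

definition gauge_fun :: "'a::real_vector set \<Rightarrow> 'a \<Rightarrow> real" where
  "gauge_fun V x = Inf {t. t > 0 \<and> inverse t *\<^sub>R x \<in> V}"

lemma gauge_fun_le: "t > 0 \<Longrightarrow> inverse t *\<^sub>R x \<in> V \<Longrightarrow> gauge_fun V x \<le> t"
  unfolding gauge_fun_def by (rule cInf_lower) (auto intro: bdd_belowI[of _ 0])

lemma gauge_fun_greatest:
  fixes V :: "'a::locally_convex_space set"
  assumes "open V" "0 \<in> V" "\<And>t. t > 0 \<Longrightarrow> inverse t *\<^sub>R x \<in> V \<Longrightarrow> m \<le> t"
  shows "m \<le> gauge_fun V x"
  unfolding gauge_fun_def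
proof (rule cInf_greatest)
  have "\<forall>\<^sub>F t in at_top. t > 0 \<and> inverse t *\<^sub>R x \<in> V"
    using eventually_inverse_scaleR_in[OF assms(1,2)] eventually_gt_at_top
    by (rule eventually_conj[rotated])
  then show "{t. t > 0 \<and> inverse t *\<^sub>R x \<in> V} \<noteq> {}"
    using eventually_happens'[OF trivial_limit_at_top_linorder] by blast
qed (use assms(3) in auto)

lemma sublinear_gauge_fun:
  fixes V :: "'a::locally_convex_space set"
  assumes V: "open V" "convex V" "0 \<in> V"
  shows "sublinear (gauge_fun V)"
  unfolding sublinear_def
proof (intro conjI allI impI)
  fix x y :: 'a
  have le: "gauge_fun V (x + y) \<le> s + t"
    if s: "s > 0" "inverse s *\<^sub>R x \<in> V" and t: "t > 0" "inverse t *\<^sub>R y \<in> V" for s t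
  proof (rule gauge_fun_le)
    \<comment> \<open>This convex combination equals
      \<open>inverse (s + t) *\<^sub>R (x + y)\<close>.\<close>
    have "(s / (s + t)) *\<^sub>R (inverse s *\<^sub>R x) + (t / (s + t)) *\<^sub>R (inverse t *\<^sub>R y) \<in> V"
      using s t
      by (intro convexD[OF V(2)]) (auto simp: add_divide_distrib[symmetric])
    then show "inverse (s + t) *\<^sub>R (x + y) \<in> V"
      using s t by (simp add: scaleR_right_distrib field_simps)
  qed (use s t in simp)
  have "gauge_fun V (x + y) - s \<le> gauge_fun V y" if s: "s > 0" "inverse s *\<^sub>R x \<in> V" for s
    using le[OF s] by (intro gauge_fun_greatest[OF V(1,3)]) (simp add: algebra_simps)
  then have "gauge_fun V (x + y) - gauge_fun V y \<le> gauge_fun V x"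
    by (intro gauge_fun_greatest[OF V(1,3)]) (simp add: algebra_simps)
  then show "gauge_fun V (x + y) \<le> gauge_fun V x + gauge_fun V y" by simp
next
  fix c :: real and x assume c: "c > 0"
  have "inverse c * gauge_fun V (c *\<^sub>R x) \<le> gauge_fun V x"
  proof (rule gauge_fun_greatest[OF V(1,3)])
    fix t :: real assume "t > 0" "inverse t *\<^sub>R x \<in> V"
    then have "gauge_fun V (c *\<^sub>R x) \<le> c * t"
      using c by (intro gauge_fun_le) (auto simp: field_simps)
    then show "inverse c * gauge_fun V (c *\<^sub>R x) \<le> t" using c by (simp add: field_simps)
  qed
  then show "gauge_fun V (c *\<^sub>R x) \<le> c * gauge_fun V x" using c by (simp add: field_simps)
qed

text \<open>Hahn-Banach for the gauge of \<open>V\<close>, with equality at \<open>z\<close>: the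
  gauge is at most 1 on \<open>V\<close> and at least 1 at \<open>z\<close>. Boundedness on
  \<open>V\<close> also gives continuity.\<close>

lemma top_dual_separation:
  fixes V :: "'a::locally_convex_space set"
  assumes V: "open V" "convex V" "0 \<in> V" "\<And>x. x \<in> V \<Longrightarrow> - x \<in> V" and z: "z \<notin> V"
  obtains f :: "'a top_dual" where "1 \<le> dual_apply f z" "\<And>x. x \<in> V \<Longrightarrow> \<bar>dual_apply f x\<bar> \<le> 1"
proof -
  obtain f where f: "linear f" "f \<le> gauge_fun V" "f z = gauge_fun V z"
    using Hahn_Banach_sublinear[OF sublinear_gauge_fun[OF V(1,2,3)]] by blast
  have le1: "f x \<le> 1" if "x \<in> V" for x
    using le_funD[OF f(2), of x] gauge_fun_le[of 1 x V] that by simp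
  have bound: "\<bar>f x\<bar> \<le> 1" if "x \<in> V" for x
    using le1[OF that] le1[OF V(4)[OF that]] by (simp add: linear_neg[OF f(1)] abs_le_iff)
  have "1 \<le> gauge_fun V z"
  proof (rule gauge_fun_greatest[OF V(1,3)], rule ccontr)
    fix t :: real assume t: "t > 0" "inverse t *\<^sub>R z \<in> V" "\<not> 1 \<le> t"
    \<comment> \<open>If \<open>t < 1\<close>, then \<open>z\<close> is a convex combination of two
      points of \<open>V\<close>.\<close>
    then have "t *\<^sub>R (inverse t *\<^sub>R z) + (1 - t) *\<^sub>R 0 \<in> V"
      by (intro convexD[OF V(2)] V(3)) auto
    with t z show False by simp
  qed
  moreover have "dual_apply (Abs_top_dual f) = f"
    using f(1) continuous_on_linear_bounded_nhd[OF f(1) V(1,3) bound]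
    by (simp add: Abs_top_dual_inverse)
  ultimately show thesis using f(3) bound by (intro that[of "Abs_top_dual f"]) auto
qed

section \<open>The dual cone\<close>

lemma linear_dual_apply: "linear (dual_apply f)"
  using dual_apply[of f] by simp

lemma tvs_bounded_dual_apply:
  assumes "tvs_bounded B"
  obtains M where "M > 0" "\<And>x. x \<in> B \<Longrightarrow> \<bar>dual_apply f x\<bar> \<le> M"
proof -
  let ?U = "dual_apply f -` ball 0 1"
  have "open ?U"
    using dual_apply[of f] by (intro open_vimage) auto
  moreover have "0 \<in> ?U"
    using linear_0[OF linear_dual_apply[of f]] by simp
  ultimately obtain r where r: "r > 0" "\<And>x. x \<in> B \<Longrightarrow> inverse r *\<^sub>R x \<in> ?U"
    by (rule tvs_boundedE[OF assms]) blast
  have "\<bar>dual_apply f x\<bar> \<le> r" if x: "x \<in> B" for x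
    using r(2)[OF x] r(1)
    by (simp add: linear_scale[OF linear_dual_apply] abs_mult dist_real_def field_simps)
  with r(1) show thesis by (rule that)
qed

section \<open>Order intervals of the dual as pointwise bounds on \<open>K\<close>\<close>

lemma order_interval_dual_cone_iff:
  "g \<in> order_interval (dual_cone K) (- y) y \<longleftrightarrow> (\<forall>k\<in>K. \<bar>dual_apply g k\<bar> \<le> dual_apply y k)"
proof -
  have "- a \<le> b \<longleftrightarrow> 0 \<le> b + a" for a b :: real by linarith
  then show ?thesis
    by (auto simp: order_interval_def cone_le_def dual_cone_def minus_top_dual.rep_eq
        plus_top_dual.rep_eq abs_le_iff)
qed

lemma balanced_order_interval_dual_cone:
  fixes K :: "'a::locally_convex_space set"
  shows "balanced (order_interval (dual_cone K) (- y) y)"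
  unfolding balanced_def
proof (intro ballI allI impI, unfold order_interval_dual_cone_iff, intro ballI)
  fix f and c :: real and k :: 'a
  assume "\<forall>k\<in>K. \<bar>dual_apply f k\<bar> \<le> dual_apply y k" "\<bar>c\<bar> \<le> 1" "k \<in> K"
  then show "\<bar>dual_apply (c *\<^sub>R f) k\<bar> \<le> dual_apply y k"
    using mult_left_le_one_le[of "\<bar>dual_apply f k\<bar>" "\<bar>c\<bar>"]
    by (auto simp: scaleR_top_dual.rep_eq abs_mult intro: order_trans)
qed

lemma convex_order_interval_dual_cone:
  fixes K :: "'a::locally_convex_space set"
  shows "convex (order_interval (dual_cone K) (- y) y)"
  unfolding convex_def
proof (intro ballI allI impI, unfold order_interval_dual_cone_iff, intro ballI)
  fix f g and u v :: real and k :: 'a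
  assume f: "\<forall>k\<in>K. \<bar>dual_apply f k\<bar> \<le> dual_apply y k"
    and g: "\<forall>k\<in>K. \<bar>dual_apply g k\<bar> \<le> dual_apply y k"
    and uv: "0 \<le> u" "0 \<le> v" "u + v = 1" and k: "k \<in> K"
  have "\<bar>dual_apply (u *\<^sub>R f + v *\<^sub>R g) k\<bar> \<le> u * \<bar>dual_apply f k\<bar> + v * \<bar>dual_apply g k\<bar>"
    using uv abs_triangle_ineq[of "u * dual_apply f k" "v * dual_apply g k"]
    by (simp add: plus_top_dual.rep_eq scaleR_top_dual.rep_eq abs_mult)
  also have "\<dots> \<le> dual_apply y k"
    using f g k uv by (intro convex_bound_le) auto
  finally show "\<bar>dual_apply (u *\<^sub>R f + v *\<^sub>R g) k\<bar> \<le> dual_apply y k" .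
qed

text \<open>A functional outside the interval violates the bound at some \<open>k\<close>, and so
  does every functional whose value at \<open>k\<close> differs by less than the excess; the
  singleton of \<open>k\<close> is bounded.\<close>

lemma closedin_order_interval_dual_cone:
  "closedin strong_dual_topology (order_interval (dual_cone K) (- y) y)"
  (is "closedin _ ?A")
  unfolding closedin_def topspace_strong_dual_topology openin_strong_dual_topology
    strong_dual_open_def
proof (intro conjI ballI)
  fix f assume "f \<in> UNIV - ?A"
  then obtain k where k: "k \<in> K" "dual_apply y k < \<bar>dual_apply f k\<bar>"
    by (auto simp: order_interval_dual_cone_iff not_le)
  then show "\<exists>B e. tvs_bounded B \<and> e > 0 \<and>
      {g. \<forall>x\<in>B. \<bar>dual_apply g x - dual_apply f x\<bar> < e} \<subseteq> UNIV - ?A"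
    by (intro exI[of _ "{k}"] exI[of _ "\<bar>dual_apply f k\<bar> - dual_apply y k"])
      (auto simp: tvs_bounded_singleton order_interval_dual_cone_iff dest!: bspec[of K _ k])
qed simp

section \<open>Bounded slices, order units and the Baire-like case\<close>

lemma weak_property_pi_imp_order_unit:
  fixes K :: "'a::locally_convex_space set"
  assumes K: "conic K" and "weak_property_pi K"
  shows "\<exists>p. order_unit (dual_cone K) p"
proof -
  obtain f \<alpha> where f: "f \<in> dual_cone K" and \<alpha>: "\<alpha> > 0"
    and bdd: "tvs_bounded (K \<inter> {x. dual_apply f x \<le> \<alpha>})"
    using assms(2) unfolding weak_property_pi_def by blast
  have "\<exists>n\<in>{1..}. g \<in> order_interval (dual_cone K) (- (real n *\<^sub>R f)) (real n *\<^sub>R f)" for g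
  proof -
    obtain M where M: "M > 0"
        "\<And>x. x \<in> K \<Longrightarrow> dual_apply f x \<le> \<alpha> \<Longrightarrow> \<bar>dual_apply g x\<bar> \<le> M"
      using tvs_bounded_dual_apply[OF bdd, of g] by (metis IntI mem_Collect_eq)
    obtain n :: nat where n: "M / \<alpha> \<le> real n" using real_arch_simple by blast
    have n1: "n \<ge> 1"
      using less_le_trans[OF divide_pos_pos[OF M(1) \<alpha>] n] by simp
    \<comment> \<open>Nonnegative multiples of \<open>k\<close> stay in \<open>K\<close>, so
      \<open>t *\<^sub>R k\<close> lies in the slice.\<close>
    have dom: "t * \<bar>dual_apply g k\<bar> \<le> M"
      if "k \<in> K" "t \<ge> 0" "t * dual_apply f k \<le> \<alpha>" for t k
      using M(2)[of "t *\<^sub>R k"] that K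
      by (simp add: conic_def linear_scale[OF linear_dual_apply] abs_mult)
    have "\<bar>dual_apply g k\<bar> \<le> real n * dual_apply f k" if k: "k \<in> K" for k
    proof (cases "dual_apply f k = 0")
      case True
      have "\<bar>dual_apply g k\<bar> = 0"
      proof (rule ccontr)
        assume "\<bar>dual_apply g k\<bar> \<noteq> 0"
        then show False
          \<comment> \<open>Here the whole ray through \<open>k\<close> lies in the slice; this
            multiple would give the value \<open>M + 1\<close>.\<close>
          using dom[OF k, of "(M + 1) / \<bar>dual_apply g k\<bar>"] True M(1) \<alpha> by simp
      qed
      with True show ?thesis by simp
    next
      case False
      with f k have pos: "dual_apply f k > 0" by (force simp: dual_cone_def)
      \<comment> \<open>This multiple of \<open>k\<close> lies on the face of the slice where
        \<open>f\<close> equals \<open>\<alpha>\<close>.\<close>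
      from dom[OF k, of "\<alpha> / dual_apply f k"] pos \<alpha>
      have "\<bar>dual_apply g k\<bar> \<le> M / \<alpha> * dual_apply f k" by (simp add: field_simps)
      also have "\<dots> \<le> real n * dual_apply f k" using n pos by (intro mult_right_mono) auto
      finally show ?thesis .
    qed
    with n1 show ?thesis
      by (intro bexI[of _ n]) (auto simp: order_interval_dual_cone_iff scaleR_top_dual.rep_eq)
  qed
  with f show ?thesis unfolding order_unit_def by (intro exI[of _ f]) auto
qed

text \<open>A bipolar argument. If \<open>inverse t *\<^sub>R x\<close> misses \<open>V\<close> for
  a slice point \<open>x\<close>, a separating \<open>f\<close> satisfies
  \<open>t \<le> f x\<close>. A multiple of \<open>f\<close> is small on \<open>B\<close>, hence
  dominated by \<open>y\<close> on \<open>K\<close>, which gives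
  \<open>f x \<le> 2 * r / e\<close>.\<close>

lemma weak_property_pi_of_strong_nhd:
  fixes K :: "'a::locally_convex_space set"
  assumes y: "y \<in> dual_cone K" and B: "tvs_bounded B" and e: "e > 0"
    and sub: "{g. \<forall>x\<in>B. \<bar>dual_apply g x\<bar> < e} \<subseteq> order_interval (dual_cone K) (- y) y"
  shows "weak_property_pi K"
proof -
  have "tvs_bounded (K \<inter> {x. dual_apply y x \<le> 1})"
    unfolding tvs_bounded_def
  proof (intro allI impI)
    fix U :: "'a set" assume "open U \<and> 0 \<in> U"
    then obtain V where V: "open V" "convex V" "0 \<in> V" "\<And>x. x \<in> V \<Longrightarrow> - x \<in> V" and "V \<subseteq> U"
      using locally_convex_space_symmetric_nhd[of U] by metis
    obtain r where r: "r > 0" "\<And>b. b \<in> B \<Longrightarrow> inverse r *\<^sub>R b \<in> V"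
      using tvs_boundedE[OF B V(1,3)] by metis
    have in_V: "inverse t *\<^sub>R x \<in> V"
      \<comment> \<open>The summand 1 puts \<open>t\<close> strictly above the bound
        \<open>2 * r / e\<close> for \<open>f x\<close>.\<close>
      if t: "t \<ge> 2 * r / e + 1" and x: "x \<in> K" "dual_apply y x \<le> 1" for t x
    proof (rule ccontr)
      assume "inverse t *\<^sub>R x \<notin> V"
      then obtain f :: "'a top_dual" where f: "1 \<le> dual_apply f (inverse t *\<^sub>R x)"
          "\<And>x. x \<in> V \<Longrightarrow> \<bar>dual_apply f x\<bar> \<le> 1"
        using top_dual_separation[OF V] by metis
      have "0 < 2 * r / e" using r(1) e by simp
      with t have t0: "t > 0" by linarith
      \<comment> \<open>On \<open>B\<close> the functional \<open>f\<close> is at most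
        \<open>r\<close> in absolute value, so \<open>?g\<close> is at most \<open>e / 2\<close>
        there.\<close>
      let ?g = "(e / (2 * r)) *\<^sub>R f"
      have "\<bar>dual_apply ?g b\<bar> < e" if b: "b \<in> B" for b
      proof -
        have "dual_apply ?g b = e / 2 * dual_apply f (inverse r *\<^sub>R b)"
          using r(1)
          by (simp add: scaleR_top_dual.rep_eq linear_scale[OF linear_dual_apply] field_simps)
        then have "\<bar>dual_apply ?g b\<bar> = e / 2 * \<bar>dual_apply f (inverse r *\<^sub>R b)\<bar>"
          using e by (simp only: abs_mult)
        also have "\<dots> \<le> e / 2 * 1" using f(2)[OF r(2)[OF b]] e by (intro mult_left_mono) auto
        finally show ?thesis using e by simp
      qed
      with sub have "?g \<in> order_interval (dual_cone K) (- y) y" by blast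
      with x have "dual_apply ?g x \<le> 1"
        by (force simp: order_interval_dual_cone_iff)
      then have "dual_apply f x \<le> 2 * r / e"
        using r(1) e by (simp add: scaleR_top_dual.rep_eq field_simps)
      moreover have "t \<le> dual_apply f x"
        using f(1) t0 by (simp add: linear_scale[OF linear_dual_apply] field_simps)
      ultimately show False using t by linarith
    qed
    have pos: "2 * r / e + 1 > 0" using r(1) e by (simp add: add_pos_pos)
    have "x \<in> (\<lambda>x. t *\<^sub>R x) ` U"
      if "t \<ge> 2 * r / e + 1" "x \<in> K" "dual_apply y x \<le> 1" for t x
      using in_V[OF that] \<open>V \<subseteq> U\<close> pos that(1) by (subst in_scaleR_image_iff) auto
    with pos show "\<exists>r>0. \<forall>t\<ge>r. K \<inter> {x. dual_apply y x \<le> 1} \<subseteq> (\<lambda>x. t *\<^sub>R x) ` U"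
      by blast
  qed
  with y show ?thesis
    unfolding weak_property_pi_def by (intro bexI[of _ y] exI[of _ 1]) auto
qed

text \<open>The interval is closed, so it has an interior point \<open>h\<close>. The basic
  neighbourhood of \<open>h\<close> is moved to the origin by averaging.\<close>

lemma strong_nhd_of_not_rare_order_interval:
  assumes "\<not> rare strong_dual_topology (order_interval (dual_cone K) (- y) y)"
  obtains B e where "tvs_bounded B" "e > 0"
    "{g. \<forall>x\<in>B. \<bar>dual_apply g x\<bar> < e} \<subseteq> order_interval (dual_cone K) (- y) y"
proof -
  let ?A = "order_interval (dual_cone K) (- y) y"
  have "strong_dual_topology interior_of ?A \<noteq> {}"
    using assms by (simp add: rare_def closure_of_closedin closedin_order_interval_dual_cone)
  then obtain W h where "strong_dual_open W" "W \<subseteq> ?A" "h \<in> W"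
    by (auto simp: interior_of_def openin_strong_dual_topology)
  then obtain B e where B: "tvs_bounded B" "e > 0"
      and sub: "{g. \<forall>x\<in>B. \<bar>dual_apply g x - dual_apply h x\<bar> < e} \<subseteq> ?A"
    unfolding strong_dual_open_def by (meson order_trans)
  have "d \<in> ?A" if d: "\<forall>x\<in>B. \<bar>dual_apply d x\<bar> < e" for d
  proof -
    \<comment> \<open>Twice \<open>d\<close> is the difference of \<open>h + d\<close> and
      \<open>h - d\<close>, so the triangle inequality on \<open>K\<close> bounds \<open>d\<close>
      by \<open>y\<close>.\<close>
    have "h + d \<in> ?A" "h - d \<in> ?A"
      using d sub by (auto simp: plus_top_dual.rep_eq minus_top_dual.rep_eq)
    then show ?thesis
      by (force simp: order_interval_dual_cone_iff plus_top_dual.rep_eq minus_top_dual.rep_eq)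
  qed
  then show thesis using B by (intro that) auto
qed

lemma weak_property_pi_of_baire_like:
  fixes K :: "'a::locally_convex_space set" and x :: "nat \<Rightarrow> 'a top_dual"
  assumes baire: "baire_like (strong_dual_topology :: 'a top_dual topology)"
    and x: "\<And>n. n \<ge> 1 \<Longrightarrow> x n \<in> dual_cone K"
    and cover: "UNIV = (\<Union>n\<in>{1..}. order_interval (dual_cone K)
                      (- (real n *\<^sub>R x n)) (real n *\<^sub>R x n))"
  shows "weak_property_pi K"
proof -
  \<comment> \<open>The given intervals need not be nested. On \<open>K\<close> all summands are
    nonnegative, so \<open>y n\<close> increases with \<open>n\<close> and dominates its last
    summand.\<close>
  define y where "y n = (\<Sum>i\<le>n. real i *\<^sub>R x i)" for n
  define A where "A n = order_interval (dual_cone K) (- y n) (y n)" for n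
  have y_apply: "dual_apply (y n) k = (\<Sum>i\<le>n. real i * dual_apply (x i) k)" for n k
    unfolding y_def
    by (induction n) (simp_all add: zero_top_dual.rep_eq plus_top_dual.rep_eq scaleR_top_dual.rep_eq)
  have nonneg: "0 \<le> real i * dual_apply (x i) k" if "k \<in> K" for i k
    \<comment> \<open>Nothing is known about \<open>x 0\<close>, but its coefficient is
      \<open>real 0\<close>.\<close>
    using x[of i] that by (cases i) (auto simp: dual_cone_def)
  have y_mem: "y n \<in> dual_cone K" for n
    by (auto simp: dual_cone_def y_apply intro!: sum_nonneg nonneg)
  have "incseq A"
  proof (rule incseq_SucI)
    fix n
    show "A n \<subseteq> A (Suc n)"
      using nonneg[of _ "Suc n"]
      by (force simp: A_def order_interval_dual_cone_iff y_apply)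
  qed
  moreover have "(\<Union>n. A n) = UNIV"
  proof (intro set_eqI iffI UNIV_I)
    fix g :: "'a top_dual"
    obtain n where "g \<in> order_interval (dual_cone K) (- (real n *\<^sub>R x n)) (real n *\<^sub>R x n)"
      using cover by blast
    then have g: "\<bar>dual_apply g k\<bar> \<le> real n * dual_apply (x n) k" if "k \<in> K" for k
      using that by (simp add: order_interval_dual_cone_iff scaleR_top_dual.rep_eq)
    have "real n * dual_apply (x n) k \<le> dual_apply (y n) k" if "k \<in> K" for k
      unfolding y_apply by (rule member_le_sum) (use nonneg that in auto)
    with g have "g \<in> A n" by (force simp: A_def order_interval_dual_cone_iff)
    then show "g \<in> (\<Union>n. A n)" by blast
  qed
  ultimately obtain n where "\<not> rare strong_dual_topology (A n)"
    using baire unfolding baire_like_def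
    by (metis A_def balanced_order_interval_dual_cone convex_order_interval_dual_cone top_greatest)
  then obtain B e where "tvs_bounded B" "e > 0"
      "{g. \<forall>x\<in>B. \<bar>dual_apply g x\<bar> < e} \<subseteq> order_interval (dual_cone K) (- y n) (y n)"
    unfolding A_def by (rule strong_nhd_of_not_rare_order_interval)
  with y_mem show ?thesis by (rule weak_property_pi_of_strong_nhd)
qed

theorem theorem3p8:
  fixes K :: "'a::locally_convex_space set"
  assumes "convex_cone K" and "pointed K"
  shows
    "(weak_property_pi K \<longrightarrow> (\<exists>p. order_unit (dual_cone K) p)) \<and>
     ((\<exists>p. order_unit (dual_cone K) p) \<longrightarrow>
        (\<exists>x :: nat \<Rightarrow> 'a top_dual. (\<forall>n\<ge>1. x n \<in> dual_cone K) \<and>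
           UNIV = (\<Union>n\<in>{1..}. order_interval (dual_cone K)
                      (- (real n *\<^sub>R x n)) (real n *\<^sub>R x n)))) \<and>
     (baire_like (strong_dual_topology :: 'a top_dual topology) \<longrightarrow>
        (\<exists>x :: nat \<Rightarrow> 'a top_dual. (\<forall>n\<ge>1. x n \<in> dual_cone K) \<and>
           UNIV = (\<Union>n\<in>{1..}. order_interval (dual_cone K)
                      (- (real n *\<^sub>R x n)) (real n *\<^sub>R x n))) \<longrightarrow>
        weak_property_pi K)"
proof (intro conjI impI)
  assume "weak_property_pi K"
  with assms show "\<exists>p. order_unit (dual_cone K) p"
    by (intro weak_property_pi_imp_order_unit) (auto simp: convex_cone_def)
next
  assume "\<exists>p. order_unit (dual_cone K) p"
  then obtain p where "order_unit (dual_cone K) p" ..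
  then show "\<exists>x :: nat \<Rightarrow> 'a top_dual. (\<forall>n\<ge>1. x n \<in> dual_cone K) \<and>
           UNIV = (\<Union>n\<in>{1..}. order_interval (dual_cone K)
                      (- (real n *\<^sub>R x n)) (real n *\<^sub>R x n))"
    \<comment> \<open>A constant sequence suffices.\<close>
    unfolding order_unit_def by (intro exI[of _ "\<lambda>_. p"]) simp
next
  assume "baire_like (strong_dual_topology :: 'a top_dual topology)"
    and "\<exists>x :: nat \<Rightarrow> 'a top_dual. (\<forall>n\<ge>1. x n \<in> dual_cone K) \<and>
           UNIV = (\<Union>n\<in>{1..}. order_interval (dual_cone K)
                      (- (real n *\<^sub>R x n)) (real n *\<^sub>R x n))"
  then show "weak_property_pi K"
    using weak_property_pi_of_baire_like by blast
qed

end
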